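(* Hall's universal locally finite group is binate, has commuting conjugates, but is not dissipated.
   Context: Hall's universal locally finite group is the countable locally finite group $U$ such that every finite group embeds into $U$, and any two embeddings of a given finite group into $U$ are conjugate by an element of $U$. We write ${}^t g = tgt^{-1}$, ${}^t H = tHt^{-1}$, and $\mathrm{supp}(g) = \{x : g(x) \neq x\}$. A group $\Gamma$ is *binate* if for every finitely generated subgroup $H \leq \Gamma$ there exist a homomorphism $f \colon H \to \Gamma$ with $[H, f(H)] = 1$ and an element $t \in \Gamma$ such that ${}^t f(h) = h \cdot f(h)$ for all $h \in H$. A group $\Gamma$ has *commuting conjugates* if for every finitely generated subgroup $H \leq \Gamma$ there exists $t \in \Gamma$ such that $[H, {}^t H] = 1$. *Dissipated.* Let $X$ be a set written as a directed union of a direct system of subsets $(X_i)_{i \in I}$ and let $\Gamma$ be a group of bijections of $X$ that is boundedly supported, i.e. every $g \in \Gamma$ satisfies $\mathrm{supp}(g) \subset X_i$ for some $i$. A *dissipator* for $\Gamma$ and $X_i$ is an element $t_i \in \Gamma$ such that (1) $t_i^p(X_i) \cap X_i = \emptyset$ for all $p \geq 1$; (2) for every $g \in \Gamma$ supported on $X_i$, the bijection $f(g)$ which equals ${}^{t_i^p} g$ on $t_i^p(X_i)$ for every $p \geq 1$ and equals the identity elsewhere belongs to $\Gamma$. The group $\Gamma$ is *dissipated* if there is a dissipator for $\Gamma$ and $X_i$ for every $i \in I$. An abstract group is called dissipated if it can be realised as such a group of bijections for some set $X$ and some system $(X_i)_{i\in I}$. *)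

theory Defs
  imports "HOL-Algebra.Bij" "HOL-Algebra.Generated_Groups" "HOL-Algebra.Weak_Morphisms"
    "HOL-Library.Countable_Set"
begin

definition conj_by :: "('a, 'b) monoid_scheme \<Rightarrow> 'a \<Rightarrow> 'a \<Rightarrow> 'a"
  where "conj_by G t g = t \<otimes>\<^bsub>G\<^esub> g \<otimes>\<^bsub>G\<^esub> inv\<^bsub>G\<^esub> t"

text \<open>The two-subgroup version of \<^const>\<open>derived\<close>.\<close>

definition mutual_commutator :: "('a, 'b) monoid_scheme \<Rightarrow> 'a set \<Rightarrow> 'a set \<Rightarrow> 'a set"
  where "mutual_commutator G H K =
    generate G (\<Union>h \<in> H. \<Union>k \<in> K. {h \<otimes>\<^bsub>G\<^esub> k \<otimes>\<^bsub>G\<^esub> inv\<^bsub>G\<^esub> h \<otimes>\<^bsub>G\<^esub> inv\<^bsub>G\<^esub> k})"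

definition fg_subgroup :: "'a set \<Rightarrow> ('a, 'b) monoid_scheme \<Rightarrow> bool"
  where "fg_subgroup H G \<longleftrightarrow> (\<exists>S. finite S \<and> S \<subseteq> carrier G \<and> H = generate G S)"

text \<open>
  A definition cannot quantify over types, so the finite groups range over those with elements
  in \<^typ>\<open>nat\<close>. Every finite group is isomorphic to one of these; the lemmas \<open>finite_embeds\<close> and
  \<open>embeddings_conj\<close> below transfer the two conditions to finite groups over arbitrary types.
\<close>

locale hall_universal_group = group U for U :: "('a, 'b) monoid_scheme" (structure) +
  assumes countable_carrier: "countable (carrier U)"
    and locally_finite: "fg_subgroup H U \<Longrightarrow> finite H"
    and nat_embeds:
      "\<And>F :: nat monoid. \<lbrakk>group F; finite (carrier F)\<rbrakk> \<Longrightarrow> mon F U \<noteq> {}"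
    and nat_embeddings_conj:
      "\<And>F :: nat monoid. \<lbrakk>group F; finite (carrier F); \<phi> \<in> mon F U; \<psi> \<in> mon F U\<rbrakk>
        \<Longrightarrow> \<exists>u \<in> carrier U. \<forall>x \<in> carrier F. \<psi> x = conj_by U u (\<phi> x)"

lemma finite_group_iso_nat:
  fixes F :: "('c, 'd) monoid_scheme"
  assumes "group F" and fin: "finite (carrier F)"
  obtains N :: "nat monoid" and e
  where "group N" "finite (carrier N)" "e \<in> iso F N"
proof -
  obtain e :: "'c \<Rightarrow> nat" where e: "inj_on e (carrier F)"
    using finite_imp_inj_to_nat_seg[OF fin] by auto
  show thesis
  proof (rule that)
    show "group (image_group e F)"
      using group.inj_imp_image_group_is_group[OF assms(1) e] .
    show "finite (carrier (image_group e F))"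
      using fin by (simp add: image_group_def)
    show "e \<in> iso F (image_group e F)"
      using inj_imp_image_group_iso[OF e] .
  qed
qed

context hall_universal_group
begin

lemma finite_embeds:
  fixes F :: "('c, 'd) monoid_scheme"
  assumes "group F" "finite (carrier F)"
  shows "mon F U \<noteq> {}"
proof -
  obtain N :: "nat monoid" and e where N: "group N" "finite (carrier N)" "e \<in> iso F N"
    using finite_group_iso_nat[OF assms] by metis
  obtain \<phi> where \<phi>: "\<phi> \<in> mon N U" using nat_embeds[OF N(1,2)] by blast
  have "\<phi> \<circ> e \<in> mon F U"
    using N(3) \<phi> by (intro mon_compose[of e F N]) (simp_all add: iso_iff_mon_epi)
  then show ?thesis by blast
qed

lemma embeddings_conj:
  fixes F :: "('c, 'd) monoid_scheme"
  assumes "group F" "finite (carrier F)" "\<phi> \<in> mon F U" "\<psi> \<in> mon F U"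
  shows "\<exists>u \<in> carrier U. \<forall>x \<in> carrier F. \<psi> x = conj_by U u (\<phi> x)"
proof -
  obtain N :: "nat monoid" and e where N: "group N" "finite (carrier N)" "e \<in> iso F N"
    using finite_group_iso_nat[OF assms(1,2)] by metis
  define d where "d = inv_into (carrier F) e"
  have d: "d \<in> iso N F" using group.iso_set_sym[OF assms(1) N(3)] by (simp add: d_def)
  have "\<chi> \<circ> d \<in> mon N U" if "\<chi> \<in> mon F U" for \<chi>
    using d that by (intro mon_compose[of d N F]) (simp_all add: iso_iff_mon_epi)
  then have "\<phi> \<circ> d \<in> mon N U" "\<psi> \<circ> d \<in> mon N U"
    using assms(3,4) by blast+
  from nat_embeddings_conj[OF N(1,2) this]
  obtain u where u: "u \<in> carrier U"
      "\<And>y. y \<in> carrier N \<Longrightarrow> \<psi> (d y) = conj_by U u (\<phi> (d y))"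
    by (metis comp_apply)
  have "\<psi> x = conj_by U u (\<phi> x)" if "x \<in> carrier F" for x
  proof -
    have "e x \<in> carrier N" "d (e x) = x"
      using N(3) that by (auto simp: d_def iso_def bij_betw_def)
    then show ?thesis using u(2)[of "e x"] by simp
  qed
  then show ?thesis using u(1) by blast
qed

end

definition binate :: "('a, 'b) monoid_scheme \<Rightarrow> bool"
  where "binate G \<longleftrightarrow>
    (\<forall>H. fg_subgroup H G \<longrightarrow>
      (\<exists>f \<in> hom (G\<lparr>carrier := H\<rparr>) G. \<exists>t \<in> carrier G.
        mutual_commutator G H (f ` H) = {\<one>\<^bsub>G\<^esub>} \<and>
        (\<forall>h \<in> H. conj_by G t (f h) = h \<otimes>\<^bsub>G\<^esub> f h)))"

definition commuting_conjugates :: "('a, 'b) monoid_scheme \<Rightarrow> bool"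
  where "commuting_conjugates G \<longleftrightarrow>
    (\<forall>H. fg_subgroup H G \<longrightarrow>
      (\<exists>t \<in> carrier G. mutual_commutator G H (conj_by G t ` H) = {\<one>\<^bsub>G\<^esub>}))"

definition supp_on :: "'x set \<Rightarrow> ('x \<Rightarrow> 'x) \<Rightarrow> 'x set"
  where "supp_on X g = {x \<in> X. g x \<noteq> x}"

text \<open>A preorder \<open>r\<close> on \<open>I\<close> represents \<open>i \<le> j\<close> by \<open>(i, j) \<in> r\<close>.\<close>

definition directed_union ::
    "'x set \<Rightarrow> 'i set \<Rightarrow> ('i \<times> 'i) set \<Rightarrow> ('i \<Rightarrow> 'x set) \<Rightarrow> bool"
  where "directed_union X I r A \<longleftrightarrow>
    I \<noteq> {} \<and> preorder_on I r \<and>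
    (\<forall>i \<in> I. \<forall>j \<in> I. \<exists>k \<in> I. (i, k) \<in> r \<and> (j, k) \<in> r) \<and>
    (\<forall>i \<in> I. \<forall>j \<in> I. (i, j) \<in> r \<longrightarrow> A i \<subseteq> A j) \<and>
    X = (\<Union>i \<in> I. A i)"

text \<open>
  \<open>Y\<close> plays the role of \<open>X\<^sub>i\<close>. The \<open>f\<close> below is determined on \<open>X\<close> by \<open>g\<close> and \<open>t\<close>; as members
  of \<^term>\<open>Bij X\<close> are extensional, it is unique.
\<close>

definition dissipator ::
    "'x set \<Rightarrow> ('x \<Rightarrow> 'x) set \<Rightarrow> 'x set \<Rightarrow> ('x \<Rightarrow> 'x) \<Rightarrow> bool"
  where "dissipator X \<Gamma> Y t \<longleftrightarrow>
    t \<in> \<Gamma> \<and>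
    (\<forall>p::nat. p \<ge> 1 \<longrightarrow> (t [^]\<^bsub>BijGroup X\<^esub> p) ` Y \<inter> Y = {}) \<and>
    (\<forall>g \<in> \<Gamma>. supp_on X g \<subseteq> Y \<longrightarrow>
      (\<exists>f \<in> \<Gamma>.
        (\<forall>p::nat. p \<ge> 1 \<longrightarrow> (\<forall>x \<in> (t [^]\<^bsub>BijGroup X\<^esub> p) ` Y.
          f x = conj_by (BijGroup X) (t [^]\<^bsub>BijGroup X\<^esub> p) g x)) \<and>
        (\<forall>x \<in> X - (\<Union>p \<in> {1::nat..}. (t [^]\<^bsub>BijGroup X\<^esub> p) ` Y). f x = x)))"

definition dissipated_on ::
    "'x set \<Rightarrow> 'i set \<Rightarrow> ('i \<times> 'i) set \<Rightarrow> ('i \<Rightarrow> 'x set) \<Rightarrow> ('x \<Rightarrow> 'x) set \<Rightarrow> bool"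
  where "dissipated_on X I r A \<Gamma> \<longleftrightarrow>
    directed_union X I r A \<and>
    subgroup \<Gamma> (BijGroup X) \<and>
    (\<forall>g \<in> \<Gamma>. \<exists>i \<in> I. supp_on X g \<subseteq> A i) \<and>
    (\<forall>i \<in> I. \<exists>t. dissipator X \<Gamma> (A i) t)"

text \<open>
  The type arguments say where the points of \<open>X\<close> and the indices in \<open>I\<close> live; leaving both type
  variables free in a theorem that denies \<open>dissipated\<close> denies it for all \<open>X\<close> and \<open>I\<close>.
\<close>

definition dissipated :: "'x itself \<Rightarrow> 'i itself \<Rightarrow> ('a, 'b) monoid_scheme \<Rightarrow> bool"
  where "dissipated _ _ G \<longleftrightarrow>
    (\<exists>(X :: 'x set) (I :: 'i set) r A \<Gamma>.
      dissipated_on X I r A \<Gamma> \<and> G \<cong> (BijGroup X)\<lparr>carrier := \<Gamma>\<rparr>)"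

end

theory Submission
  imports Defs "HOL-Algebra.Elementary_Groups" "HOL-Algebra.Multiplicative_Group"
begin

text \<open>
  Every finitely generated \<open>H \<le> U\<close> is finite, and an embedding of \<open>H \<times> H\<close> into \<open>U\<close> can be
  conjugated so that it is the inclusion on the first factor. The second factor then gives an
  embedding \<open>f\<close> of \<open>H\<close> that commutes with \<open>H\<close>, and the diagonal gives the embedding
  \<open>h \<mapsto> h f(h)\<close>. Conjugating \<open>f\<close> to the diagonal embedding shows that \<open>U\<close> is binate, and
  conjugating the inclusion to \<open>f\<close> shows that it has commuting conjugates. On the other hand, a
  dissipator of a nonempty \<open>X\<^sub>i\<close> has infinite order, whereas \<open>U\<close> is a torsion group.
\<close>

text \<open>Each generator collapses to the identity once \<open>h\<close> and \<open>k\<close> are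
  swapped, and the identity generates only itself. This turns elementwise commutation into the form
  used by the two positive claims.\<close>

lemma (in group) mutual_commutator_trivial:
  assumes "H \<subseteq> carrier G" "K \<subseteq> carrier G"
    and comm: "\<And>h k. \<lbrakk>h \<in> H; k \<in> K\<rbrakk> \<Longrightarrow> h \<otimes> k = k \<otimes> h"
  shows "mutual_commutator G H K = {\<one>}"
proof -
  have "h \<otimes> k \<otimes> inv h \<otimes> inv k = \<one>" if "h \<in> H" "k \<in> K" for h k
  proof -
    have hk: "h \<in> carrier G" "k \<in> carrier G" using that assms by auto
    have "h \<otimes> k \<otimes> inv h \<otimes> inv k = k \<otimes> (h \<otimes> inv h) \<otimes> inv k"
      using hk comm[OF that] by (simp add: m_assoc del: r_inv)
    then show ?thesis using hk by simp
  qed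
  then have "(\<Union>h\<in>H. \<Union>k\<in>K. {h \<otimes> k \<otimes> inv h \<otimes> inv k}) \<subseteq> {\<one>}"
    by auto
  then have "mutual_commutator G H K \<subseteq> {\<one>}"
    using mono_generate[of _ "{\<one>}"] by (simp add: mutual_commutator_def generate_one)
  then show ?thesis
    unfolding mutual_commutator_def using generate.one by blast
qed

lemma (in group) conj_by_mult:
  assumes "u \<in> carrier G" "x \<in> carrier G" "y \<in> carrier G"
  shows "conj_by G u (x \<otimes> y) = conj_by G u x \<otimes> conj_by G u y"
proof -
  have "inv u \<otimes> (u \<otimes> (y \<otimes> inv u)) = y \<otimes> inv u"
    using assms by (simp flip: m_assoc)
  then show ?thesis using assms by (simp add: conj_by_def m_assoc)
qed

text \<open>Allows an embedding to be normalised by an inner automorphism while remaining an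
  embedding.\<close>

lemma (in group) conj_by_mon:
  assumes "u \<in> carrier G" "\<phi> \<in> mon F G"
  shows "(\<lambda>x. conj_by G u (\<phi> x)) \<in> mon F G"
proof -
  have \<phi>: "\<phi> \<in> hom F G" "inj_on \<phi> (carrier F)" using assms(2) by (auto simp: mon_def)
  have car: "\<phi> x \<in> carrier G" if "x \<in> carrier F" for x
    using \<phi>(1) that by (rule hom_in_carrier)
  have "(\<lambda>x. conj_by G u (\<phi> x)) \<in> hom F G"
    using assms(1) \<phi>(1) car
    by (auto intro!: homI simp: conj_by_mult hom_mult) (simp add: conj_by_def)
  moreover have "inj_on (\<lambda>x. conj_by G u (\<phi> x)) (carrier F)"
    using \<phi>(2) assms(1) car by (auto simp: inj_on_def conj_by_def)
  ultimately show ?thesis by (simp add: mon_def)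
qed

context hall_universal_group
begin

lemma commuting_embedding:
  assumes H: "subgroup H U" "finite H"
  obtains f where "f \<in> mon (U\<lparr>carrier := H\<rparr>) U"
    "(\<lambda>h. h \<otimes> f h) \<in> mon (U\<lparr>carrier := H\<rparr>) U"
    "\<And>h k. \<lbrakk>h \<in> H; k \<in> H\<rbrakk> \<Longrightarrow> h \<otimes> f k = f k \<otimes> h"
proof -
  let ?H = "U\<lparr>carrier := H\<rparr>"
  let ?P = "?H \<times>\<times> ?H"
  interpret H: group ?H using H(1) by (rule subgroup_imp_group)
  note sub = subgroup.mem_carrier[OF H(1)]
  have "group ?P" "finite (carrier ?P)"
    using H(2) H.is_group by (auto intro: DirProd_group)
  then obtain \<phi> where \<phi>: "\<phi> \<in> mon ?P U" using finite_embeds by blast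
  have one: "\<one> \<in> H" using H(1) by (rule subgroup.one_closed)
  have closed: "x \<otimes> y \<in> H" if "x \<in> H" "y \<in> H" for x y
    using subgroup.m_closed[OF H(1)] that .
  have fst_mon: "(\<lambda>h. (h, \<one>)) \<in> mon ?H ?P"
    using one sub by (auto simp: mon_def hom_def inj_on_def)
  have incl: "(\<lambda>h. h) \<in> mon ?H U"
    using sub by (auto simp: mon_def hom_def)
  \<comment> \<open>The inclusion and the restriction of \<open>\<phi>\<close> to the first factor
    are two embeddings of \<open>H\<close>, hence conjugate; \<open>u\<close> carries the latter to
    the former.\<close>
  obtain u where u: "u \<in> carrier U" "\<And>h. h \<in> H \<Longrightarrow> h = conj_by U u (\<phi> (h, \<one>))"
    using embeddings_conj[OF H.is_group _ mon_compose[OF fst_mon \<phi>] incl] H(2) by auto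
  define \<psi> where "\<psi> = (\<lambda>x. conj_by U u (\<phi> x))"
  have \<psi>: "\<psi> \<in> mon ?P U" unfolding \<psi>_def using u(1) \<phi> by (rule conj_by_mon)
  have \<psi>1: "\<psi> (h, \<one>) = h" if "h \<in> H" for h using u(2)[OF that] by (simp add: \<psi>_def)
  have mult: "\<psi> (a, b) \<otimes> \<psi> (c, d) = \<psi> (a \<otimes> c, b \<otimes> d)"
    if "a \<in> H" "b \<in> H" "c \<in> H" "d \<in> H" for a b c d
    using \<psi> that hom_mult[of \<psi> ?P U "(a, b)" "(c, d)"] by (simp add: mon_def)
  \<comment> \<open>\<open>(h, \<one>)\<close> and \<open>(\<one>, k)\<close> commute with product
    \<open>(h, k)\<close>. As \<open>\<psi>\<close> is the inclusion on the first factor, this gives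
    both the commutation with \<open>H\<close> and the formula for the diagonal.\<close>
  have prod: "h \<otimes> \<psi> (\<one>, k) = \<psi> (h, k)" "\<psi> (\<one>, k) \<otimes> h = \<psi> (h, k)"
    if "h \<in> H" "k \<in> H" for h k
    using mult[of h \<one> \<one> k] mult[of \<one> k h \<one>] \<psi>1 that one sub by auto
  have snd_mon: "(\<lambda>h. (\<one>, h)) \<in> mon ?H ?P" and diag_mon: "(\<lambda>h. (h, h)) \<in> mon ?H ?P"
    using one sub by (auto simp: mon_def hom_def inj_on_def)
  show thesis
  proof (rule that)
    show "(\<lambda>h. \<psi> (\<one>, h)) \<in> mon ?H U"
      using mon_compose[OF snd_mon \<psi>] by (simp add: comp_def)
    \<comment> \<open>Injectivity comes from writing the map as \<open>\<psi> (h, h)\<close>: a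
      pointwise product of two commuting embeddings need not be injective.\<close>
    have "(\<lambda>h. \<psi> (h, h)) \<in> mon ?H U"
      using mon_compose[OF diag_mon \<psi>] by (simp add: comp_def)
    then show "(\<lambda>h. h \<otimes> \<psi> (\<one>, h)) \<in> mon ?H U"
      by (auto simp: mon_def hom_def inj_on_def Pi_def prod closed)
    show "h \<otimes> \<psi> (\<one>, k) = \<psi> (\<one>, k) \<otimes> h" if "h \<in> H" "k \<in> H" for h k
      using prod that by simp
  qed
qed

lemma fg_subgroupD:
  assumes "fg_subgroup H U"
  shows "subgroup H U" "finite H"
  using assms locally_finite generate_is_subgroup by (auto simp: fg_subgroup_def)

lemma binate: "binate U"
  unfolding binate_def
proof (intro allI impI)
  fix H assume "fg_subgroup H U"
  note H = fg_subgroupD[OF this]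
  obtain f where f: "f \<in> mon (U\<lparr>carrier := H\<rparr>) U"
      "(\<lambda>h. h \<otimes> f h) \<in> mon (U\<lparr>carrier := H\<rparr>) U"
      "\<And>h k. \<lbrakk>h \<in> H; k \<in> H\<rbrakk> \<Longrightarrow> h \<otimes> f k = f k \<otimes> h"
    by (rule commuting_embedding[OF H]) blast
  obtain t where t: "t \<in> carrier U" "\<forall>h\<in>H. h \<otimes> f h = conj_by U t (f h)"
    using embeddings_conj[OF subgroup_imp_group[OF H(1)] _ f(1,2)] H(2) by auto
  have fhom: "f \<in> hom (U\<lparr>carrier := H\<rparr>) U" using f(1) by (simp add: mon_def)
  then have "f ` H \<subseteq> carrier U" by (auto simp: hom_def)
  then have "mutual_commutator U H (f ` H) = {\<one>}"
    using f(3) subgroup.subset[OF H(1)] by (intro mutual_commutator_trivial) auto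
  with t
  have "\<exists>t\<in>carrier U.
      mutual_commutator U H (f ` H) = {\<one>} \<and> (\<forall>h\<in>H. conj_by U t (f h) = h \<otimes> f h)"
    by (intro bexI[of _ t]) auto
  with fhom show "\<exists>f\<in>hom (U\<lparr>carrier := H\<rparr>) U. \<exists>t\<in>carrier U.
      mutual_commutator U H (f ` H) = {\<one>} \<and> (\<forall>h\<in>H. conj_by U t (f h) = h \<otimes> f h)"
    by (intro bexI[of _ f])
qed

lemma commuting_conjugates: "commuting_conjugates U"
  unfolding commuting_conjugates_def
proof (intro allI impI)
  fix H assume "fg_subgroup H U"
  note H = fg_subgroupD[OF this]
  obtain f where f: "f \<in> mon (U\<lparr>carrier := H\<rparr>) U"
      "\<And>h k. \<lbrakk>h \<in> H; k \<in> H\<rbrakk> \<Longrightarrow> h \<otimes> f k = f k \<otimes> h"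
    by (rule commuting_embedding[OF H]) blast
  have incl: "(\<lambda>h. h) \<in> mon (U\<lparr>carrier := H\<rparr>) U"
    using subgroup.mem_carrier[OF H(1)] by (auto simp: mon_def hom_def)
  obtain t where t: "t \<in> carrier U" "\<forall>h\<in>H. f h = conj_by U t h"
    using embeddings_conj[OF subgroup_imp_group[OF H(1)] _ incl f(1)] H(2) by auto
  have "f ` H \<subseteq> carrier U" using f(1) by (auto simp: mon_def hom_def)
  then have "mutual_commutator U H (f ` H) = {\<one>}"
    using f(2) subgroup.subset[OF H(1)] by (intro mutual_commutator_trivial) auto
  moreover have "f ` H = conj_by U t ` H" using t(2) by (auto simp: image_iff)
  ultimately show "\<exists>t\<in>carrier U. mutual_commutator U H (conj_by U t ` H) = {\<one>}"
    using t(1) by auto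
qed

lemma torsion:
  assumes "x \<in> carrier U"
  shows "\<exists>p\<ge>1::nat. x [^] p = \<one>"
proof -
  define H where "H = generate U {x}"
  have "fg_subgroup H U" using assms by (auto simp: fg_subgroup_def H_def)
  note H = fg_subgroupD[OF this]
  interpret H: group "U\<lparr>carrier := H\<rparr>" using H(1) by (rule subgroup_imp_group)
  have x: "x \<in> carrier (U\<lparr>carrier := H\<rparr>)" by (simp add: H_def generate.incl)
  \<comment> \<open>The order is taken inside the finite group on \<open>H\<close>, which makes it
    positive; an element of infinite order would have \<open>ord\<close> equal to 0.\<close>
  have "group.ord (U\<lparr>carrier := H\<rparr>) x \<ge> 1" using H(2) x by (intro H.ord_ge_1) auto
  moreover have "x [^] (group.ord (U\<lparr>carrier := H\<rparr>) x) = \<one>"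
    using H.pow_ord_eq_1[OF x] by (simp flip: nat_pow_consistent)
  ultimately show ?thesis by blast
qed

text \<open>The cyclic group of order 2 embeds into \<open>U\<close>. The trivial group has to be
  excluded because it is dissipated, acting on the empty set.\<close>

lemma nontrivial: "carrier U \<noteq> {\<one>}"
proof
  assume U: "carrier U = {\<one>}"
  have c: "carrier (integer_mod_group 2) = {0..<2}"
    by (simp add: carrier_integer_mod_group)
  obtain \<phi> where \<phi>: "\<phi> \<in> mon (integer_mod_group 2) U"
    using finite_embeds[of "integer_mod_group 2"] c by auto
  then have "\<phi> 0 = \<phi> 1" using U c by (auto simp: mon_def hom_def Pi_def)
  moreover have "inj_on \<phi> {0..<2}" using \<phi> c by (simp add: mon_def)
  ultimately have "(0::int) = 1" by (auto dest: inj_onD)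
  then show False by simp
qed

end

lemma dissipator_finite_order_empty:
  assumes "dissipator X \<Gamma> Y t" "Y \<subseteq> X" "p \<ge> 1" "t [^]\<^bsub>BijGroup X\<^esub> (p::nat) = \<one>\<^bsub>BijGroup X\<^esub>"
  shows "Y = {}"
proof -
  have "(t [^]\<^bsub>BijGroup X\<^esub> p) ` Y \<inter> Y = {}"
    using assms(1,3) by (simp add: dissipator_def)
  moreover have "(t [^]\<^bsub>BijGroup X\<^esub> p) ` Y = Y"
    \<comment> \<open>The unit of \<open>BijGroup X\<close> is the identity only on
      \<open>X\<close>, so it fixes the points of \<open>Y\<close> because
      \<open>Y \<subseteq> X\<close>.\<close>
    using assms(2,4) by (auto simp: BijGroup_def image_iff)
  ultimately show ?thesis by simp
qed

text \<open>Each dissipator has finite order, which forces every \<open>A i\<close> to be empty.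
  Their union \<open>X\<close> is then empty, and its group of bijections is trivial.\<close>

lemma torsion_dissipated_trivial:
  assumes G: "group G"
    and torsion: "\<And>x. x \<in> carrier G \<Longrightarrow> \<exists>p\<ge>1::nat. x [^]\<^bsub>G\<^esub> p = \<one>\<^bsub>G\<^esub>"
    and diss: "dissipated TYPE('x) TYPE('i) G"
  shows "carrier G = {\<one>\<^bsub>G\<^esub>}"
proof -
  interpret group G by (rule G)
  obtain X :: "'x set" and I :: "'i set" and r A \<Gamma>
    where D: "dissipated_on X I r A \<Gamma>" and "G \<cong> (BijGroup X)\<lparr>carrier := \<Gamma>\<rparr>"
    using diss by (auto simp: dissipated_def)
  then obtain h where h: "h \<in> iso G ((BijGroup X)\<lparr>carrier := \<Gamma>\<rparr>)" by (auto simp: is_iso_def)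
  have sub: "subgroup \<Gamma> (BijGroup X)" using D by (simp add: dissipated_on_def)
  interpret B: group "BijGroup X" by (rule group_BijGroup)
  have grp: "group ((BijGroup X)\<lparr>carrier := \<Gamma>\<rparr>)" using sub by (rule B.subgroup_imp_group)
  have hom: "h \<in> hom G ((BijGroup X)\<lparr>carrier := \<Gamma>\<rparr>)"
    and bij: "bij_betw h (carrier G) \<Gamma>"
    using h by (auto simp: iso_def)
  interpret h: group_hom G "(BijGroup X)\<lparr>carrier := \<Gamma>\<rparr>" h
    using G grp hom by (simp add: group_hom_def group_hom_axioms_def)
  have "A i = {}" if i: "i \<in> I" for i
  proof -
    obtain t where t: "dissipator X \<Gamma> (A i) t" using D i by (auto simp: dissipated_on_def)
    then have "t \<in> \<Gamma>" by (simp add: dissipator_def)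
    then obtain x where x: "x \<in> carrier G" "t = h x" using bij by (auto simp: bij_betw_def)
    obtain p :: nat where p: "p \<ge> 1" "x [^]\<^bsub>G\<^esub> p = \<one>\<^bsub>G\<^esub>" using torsion[OF x(1)] by blast
    \<comment> \<open>The isomorphism yields the power in the group on \<open>\<Gamma>\<close>,
      whereas a dissipator refers to powers in \<open>BijGroup X\<close>; the two agree.\<close>
    have "t [^]\<^bsub>(BijGroup X)\<lparr>carrier := \<Gamma>\<rparr>\<^esub> p = \<one>\<^bsub>BijGroup X\<^esub>"
      using h.hom_nat_pow[OF x(1), of p] p(2) x(2) h.hom_one by simp
    then have "t [^]\<^bsub>BijGroup X\<^esub> p = \<one>\<^bsub>BijGroup X\<^esub>"
      using B.nat_pow_consistent by metis
    moreover have "A i \<subseteq> X" using D i by (auto simp: dissipated_on_def directed_union_def)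
    ultimately show ?thesis using dissipator_finite_order_empty[OF t _ p(1)] by blast
  qed
  then have "X = {}" using D by (auto simp: dissipated_on_def directed_union_def)
  \<comment> \<open>Members of \<open>Bij X\<close> are extensional, so over the empty set they all
    equal the function that is \<open>undefined\<close> everywhere.\<close>
  then have "f = g" if "f \<in> \<Gamma>" "g \<in> \<Gamma>" for f g
    using subgroup.subset[OF sub] that by (auto simp: BijGroup_def Bij_def)
  then have "x = \<one>\<^bsub>G\<^esub>" if "x \<in> carrier G" for x
    using bij that one_closed by (metis bij_betw_apply bij_betw_inv_into_left)
  then show ?thesis by auto
qed

theorem corollary3p18:
  fixes U :: "('a, 'b) monoid_scheme"
  assumes "hall_universal_group U"
  shows "binate U \<and> commuting_conjugates U \<and> \<not> dissipated TYPE('x) TYPE('i) U"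
proof -
  interpret hall_universal_group U by (rule assms)
  have "\<not> dissipated TYPE('x) TYPE('i) U"
    using torsion_dissipated_trivial[OF is_group torsion] nontrivial by blast
  then show ?thesis using binate commuting_conjugates by simp
qed

end
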